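(* Let $\mathbf p(t)=(p_0(t),p_1(t),\ldots)$ be a solution of the system of ODEs $$p_0'=-p_0^2,\qquad p_n' = n\,p_{n+1}+p_0\,p_{n-1}-(n-1)\,p_n-p_0\,p_n\quad (n\ge 1),$$ with $\mathbf p(0)\in\mathcal S_1$. Then there exist positive constants $C_1$ and $C_2$ such that $$\frac{C_1}{t}\le G[\mathbf p(t)]\le \frac{C_2}{t}$$ for all $t\ge t_*:=\min\{s\ge 0 \mid p_0(s)\le \tfrac16\}$. In other words, the decay rate of the Gini index $G[\mathbf p(t)]$ to $G[\delta_1]=0$ is of order $1/t$, and this rate is (asymptotically) sharp.
   Context: $\mathbb N=\{0,1,2,\ldots\}$. For $\mu>0$, $\mathcal S_\mu=\{\mathbf p=(p_n)_{n\ge0} \mid p_n\ge 0,\ \sum_{n\ge0}p_n=1,\ \sum_{n\ge0} n\,p_n=\mu\}$ is the set of probability distributions on $\mathbb N$ with mean $\mu$. Total mass and mean are conserved by the system, and the solution $\mathbf p(t)$ with $\mathbf p(0)\in\mathcal S_1$ is understood to lie in $\mathcal S_1$ for all $t\ge 0$. The Gini index of a probability distribution $\mathbf p$ on $\mathbb N$ with mean $\mu>0$ is $$G[\mathbf p]=\frac{1}{2\mu}\sum_{i\in\mathbb N}\sum_{j\in\mathbb N}|i-j|\,p_i\,p_j$$ (here $\mu=1$). $\delta_1=(0,1,0,0,\ldots)$ is the Dirac distribution at $1$.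
   Formalization: If t_*=0 (p_0(0)≤1/6), C_1/t is unbounded near t=0 while G≤1, and G=0 for p(0)=δ_1; so the two-sided bound is stated for t_*>0, or for p(0)≠δ_1 and t≥t_0 for any t_0>0; order 1/t for p(0)≠δ_1; the upper bound holds always for t>0. *)

theory Defs
  imports Complex_Main "HOL-Library.Landau_Symbols"
begin

definition prob_with_mean :: "real \<Rightarrow> (nat \<Rightarrow> real) set" where
  "prob_with_mean \<mu> =
     {p. (\<forall>n. 0 \<le> p n) \<and> p sums 1 \<and> (\<lambda>n. real n * p n) sums \<mu>}"

definition mean :: "(nat \<Rightarrow> real) \<Rightarrow> real" where
  "mean p = (\<Sum>n. real n * p n)"

(* For p in prob_with_mean \<mu> with \<mu> > 0, all the series below converge. *)
definition gini :: "(nat \<Rightarrow> real) \<Rightarrow> real" where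
  "gini p = 1 / (2 * mean p) * (\<Sum>i. \<Sum>j. \<bar>real i - real j\<bar> * p i * p j)"

definition dirac :: "nat \<Rightarrow> nat \<Rightarrow> real" where
  "dirac k n = (if n = k then 1 else 0)"

(* p t n is the n-th component at time t; the derivative at time 0 is one-sided. *)
definition ode_solution :: "(real \<Rightarrow> nat \<Rightarrow> real) \<Rightarrow> bool" where
  "ode_solution p \<longleftrightarrow>
     (\<forall>t\<ge>0.
        ((\<lambda>s. p s 0) has_real_derivative - (p t 0)\<^sup>2) (at t within {0..}) \<and>
        (\<forall>n\<ge>1. ((\<lambda>s. p s n) has_real_derivative
            real n * p t (n + 1) + p t 0 * p t (n - 1) - (real n - 1) * p t n - p t 0 * p t n)
          (at t within {0..})))"

(* LEAST is the minimum of the set. For a solution in prob_with_mean 1 it exists, since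
   p s 0 is continuous and tends to 0. If p 0 0 \<le> 1/6 then t_star p = 0, and then no bound
   C1 / t \<le> gini (p t) with C1 > 0 can hold for all small t > 0, since gini (p t) \<le> 1;
   if p 0 = dirac 1 then gini (p t) = 0 for all t \<ge> 0. *)
definition t_star :: "(real \<Rightarrow> nat \<Rightarrow> real) \<Rightarrow> real" where
  "t_star p = (LEAST s. 0 \<le> s \<and> p s 0 \<le> 1 / 6)"

end

theory Submission
  imports Defs
begin

text \<open>For a distribution on the naturals with mean 1, the terms with \<open>i = 0\<close> or \<open>j = 0\<close> alone
  show that the Gini index is at least \<open>p\<^sub>0\<close>. Conversely \<open>\<bar>i - j\<bar> \<le> \<bar>i - 1\<bar> + \<bar>j - 1\<bar>\<close>
  bounds it by the mean absolute deviation from 1, which equals \<open>2 p\<^sub>0\<close> because 0 is the only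
  point left of the mean. So only the first equation matters; its solution is
  \<open>p\<^sub>0(t) = a / (1 + a t)\<close> with \<open>a = p\<^sub>0(0)\<close>.\<close>

lemma prob_with_meanD:
  assumes "p \<in> prob_with_mean \<mu>"
  shows "0 \<le> p n" "p sums 1" "(\<lambda>n. real n * p n) sums \<mu>"
  using assms by (auto simp: prob_with_mean_def)

lemma mean_eq: "p \<in> prob_with_mean \<mu> \<Longrightarrow> mean p = \<mu>"
  using prob_with_meanD(3) by (simp add: mean_def sums_iff)

lemma abs_deviation_from_one_sums:
  assumes "p \<in> prob_with_mean 1"
  shows "(\<lambda>n. \<bar>real n - 1\<bar> * p n) sums (2 * p 0)"
proof -
  \<comment> \<open>\<open>\<bar>n - 1\<bar>\<close> and \<open>n - 1\<close> differ only at
    \<open>n = 0\<close>, by 2; the signed deviation sums to \<open>1 - 1\<close>.\<close>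
  have "(\<lambda>n. real n * p n - p n + (if n = 0 then 2 * p 0 else 0)) sums (1 - 1 + 2 * p 0)"
    by (intro sums_add sums_diff prob_with_meanD[OF assms] sums_single[of 0 "\<lambda>_. 2 * p 0"])
  moreover have "real n * p n - p n + (if n = 0 then 2 * p 0 else 0) = \<bar>real n - 1\<bar> * p n" for n
    by (cases n) (auto simp: algebra_simps)
  ultimately show ?thesis by simp
qed

lemma gini_bounds:
  assumes p: "p \<in> prob_with_mean 1"
  shows "p 0 \<le> gini p" "gini p \<le> 2 * p 0"
proof -
  define S where "S i = (\<Sum>j. \<bar>real i - real j\<bar> * p i * p j)" for i
  note nonneg = prob_with_meanD(1)[OF p] and total = prob_with_meanD(2)[OF p]
    and first_moment = prob_with_meanD(3)[OF p] and dev = abs_deviation_from_one_sums[OF p]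
  \<comment> \<open>This series dominates row \<open>i\<close> of the double sum; it yields both the
    summability of the row and \<open>S_upper\<close>.\<close>
  have bound_sums: "(\<lambda>j. p i * (\<bar>real i - 1\<bar> * p j + \<bar>real j - 1\<bar> * p j)) sums
      (p i * (\<bar>real i - 1\<bar> * 1 + 2 * p 0))" for i
    by (intro sums_mult sums_add total dev)
  have le_bound: "\<bar>real i - real j\<bar> * p i * p j \<le> p i * (\<bar>real i - 1\<bar> * p j + \<bar>real j - 1\<bar> * p j)" for i j
  proof -
    have "\<bar>real i - real j\<bar> * (p i * p j) \<le> (\<bar>real i - 1\<bar> + \<bar>real j - 1\<bar>) * (p i * p j)"
      by (intro mult_right_mono) (auto simp: nonneg)
    then show ?thesis by (simp add: algebra_simps)
  qed
  have inner_summable: "summable (\<lambda>j. \<bar>real i - real j\<bar> * p i * p j)" for i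
    by (rule summable_comparison_test'[OF sums_summable[OF bound_sums], of 0])
      (use le_bound nonneg in auto)
  have S_upper: "S i \<le> p i * (\<bar>real i - 1\<bar> + 2 * p 0)" for i
    using suminf_le[OF le_bound inner_summable sums_summable[OF bound_sums]] sums_unique[OF bound_sums]
    by (simp add: S_def)
  have S_zero: "S 0 = p 0"
    using sums_unique[OF sums_mult[OF first_moment, of "p 0"]] by (simp add: S_def algebra_simps)
  have S_lower: "real i * p i * p 0 \<le> S i" for i
    using sum_le_suminf[OF inner_summable, of "{0}" i] by (simp add: S_def nonneg)
  have upper_sums: "(\<lambda>i. p i * (\<bar>real i - 1\<bar> + 2 * p 0)) sums (4 * p 0)"
    using sums_add[OF dev sums_mult[OF total, of "2 * p 0"]] by (simp add: algebra_simps)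
  have S_nonneg: "0 \<le> S i" for i
    using S_lower[of i] nonneg by (smt (verit) mult_nonneg_nonneg of_nat_0_le_iff)
  have S_summable: "summable S"
    by (rule summable_comparison_test'[OF sums_summable[OF upper_sums], of 0])
      (use S_upper S_nonneg in auto)
  \<comment> \<open>Row 0 and column 0 contribute \<open>p 0\<close> each, and their common entry is
    zero, so nothing is counted twice. The factor 1/2 in \<open>gini\<close> then leaves
    \<open>p 0\<close>.\<close>
  have "(\<lambda>i. (if i = 0 then p 0 else 0) + real i * p i * p 0) sums (p 0 + 1 * p 0)"
    by (intro sums_add sums_mult2 first_moment sums_single[of 0 "\<lambda>_. p 0"])
  moreover have "(if i = 0 then p 0 else 0) + real i * p i * p 0 \<le> S i" for i
    using S_zero S_lower by auto
  ultimately have "2 * p 0 \<le> suminf S"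
    using sums_le[OF _ _ summable_sums[OF S_summable]] by fastforce
  moreover have "suminf S \<le> 4 * p 0"
    using sums_le[OF S_upper summable_sums[OF S_summable] upper_sums] .
  moreover have "gini p = 1 / 2 * suminf S"
    by (simp add: gini_def S_def[abs_def] mean_eq[OF p])
  ultimately show "p 0 \<le> gini p" "gini p \<le> 2 * p 0" by simp_all
qed

lemma dirac_in_prob_with_mean: "dirac k \<in> prob_with_mean (real k)"
proof -
  have "(\<lambda>n. real n * dirac k n) = (\<lambda>n. if n = k then real n else 0)"
    by (auto simp: dirac_def)
  then show ?thesis
    using sums_single[of k "\<lambda>_. 1::real"] sums_single[of k real]
    by (auto simp: prob_with_mean_def dirac_def[abs_def])
qed

text \<open>The mean absolute deviation from 1 is \<open>2 * p 0\<close>, hence zero, so no mass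
  lies off 1. By contraposition, a nontrivial initial state has positive mass at 0.\<close>

lemma eq_dirac_if_zero_mass_eq_0:
  assumes p: "p \<in> prob_with_mean 1" and "p 0 = 0"
  shows "p = dirac 1"
proof -
  have "(\<lambda>n. \<bar>real n - 1\<bar> * p n) sums 0"
    using abs_deviation_from_one_sums[OF p] \<open>p 0 = 0\<close> by simp
  then have "\<forall>n. \<bar>real n - 1\<bar> * p n = 0"
    using suminf_eq_zero_iff[of "\<lambda>n. \<bar>real n - 1\<bar> * p n"] prob_with_meanD(1)[OF p]
    by (auto simp: sums_iff)
  then have off: "p n = 0" if "n \<noteq> 1" for n
    using that by (metis abs_eq_0 eq_iff_diff_eq_0 mult_eq_0_iff of_nat_1 of_nat_eq_iff)
  have "(\<lambda>n. if n = 1 then p n else 0) sums p 1" by (rule sums_single)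
  moreover have "(\<lambda>n. if n = 1 then p n else 0) = p" using off by auto
  ultimately have "p 1 = 1" using prob_with_meanD(2)[OF p] sums_unique2 by metis
  with off show ?thesis by (auto simp: dirac_def)
qed

text \<open>Multiplying by \<open>1 + a t\<close> before comparing avoids dividing by \<open>f\<close>, whose positivity is not
  known a priori: the difference \<open>w\<close> to the claimed value satisfies \<open>w' = - f w\<close>.\<close>

lemma neg_square_ode_solution:
  fixes f :: "real \<Rightarrow> real"
  assumes deriv: "\<And>t. 0 \<le> t \<Longrightarrow> (f has_real_derivative - (f t)\<^sup>2) (at t within {0..})"
    and nonneg: "\<And>t. 0 \<le> t \<Longrightarrow> 0 \<le> f t" and "0 \<le> t"
  shows "f t = f 0 / (1 + f 0 * t)"
proof -
  define a where "a = f 0"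
  define w where "w s = f s * (1 + a * s) - a" for s
  have w_deriv: "((\<lambda>s. (w s)\<^sup>2) has_real_derivative - 2 * f s * (w s)\<^sup>2) (at s within {0..t})"
    if "0 \<le> s" for s
  proof -
    have "(f has_real_derivative - (f s)\<^sup>2) (at s within {0..t})"
      by (rule DERIV_subset[OF deriv[OF that]]) auto
    then show ?thesis unfolding w_def
      by (auto intro!: derivative_eq_intros simp: algebra_simps power2_eq_square)
  qed
  \<comment> \<open>The sign of \<open>w\<close> is unknown, but its square has derivative
    \<open>- 2 * f s * (w s)\<^sup>2\<close>, which is nonpositive, and
    \<open>w 0 = 0\<close>.\<close>
  have "(w t)\<^sup>2 \<le> (w 0)\<^sup>2"
  \<comment> \<open>Only interior derivatives are used, since the one at 0 is one-sided; continuity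
    covers the endpoints.\<close>
  proof (rule DERIV_nonpos_imp_decreasing_open[OF \<open>0 \<le> t\<close>])
    show "\<exists>y. ((\<lambda>s. (w s)\<^sup>2) has_real_derivative y) (at s) \<and> y \<le> 0" if "0 < s" "s < t" for s
    proof (intro exI conjI)
      show "((\<lambda>s. (w s)\<^sup>2) has_real_derivative - 2 * f s * (w s)\<^sup>2) (at s)"
        using w_deriv[of s] that by (simp add: at_within_Icc_at)
      show "- 2 * f s * (w s)\<^sup>2 \<le> 0" using nonneg[of s] that by simp
    qed
    show "continuous_on {0..t} (\<lambda>s. (w s)\<^sup>2)"
      by (rule DERIV_continuous_on[OF w_deriv]) auto
  qed
  then have "w t = 0" by (simp add: w_def a_def)
  moreover have "0 < 1 + a * t" using nonneg[of 0] \<open>0 \<le> t\<close> by (simp add: a_def add_pos_nonneg)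
  ultimately show ?thesis by (simp add: w_def a_def field_simps)
qed

text \<open>With \<open>a = p 0 0 > 1 / 6\<close>, the decreasing function
  \<open>a / (1 + a * t)\<close> reaches 1/6 when \<open>1 + a * t = 6 * a\<close>.\<close>

lemma t_star_eq:
  assumes "0 \<le> p 0 0" and sol: "\<And>t. 0 \<le> t \<Longrightarrow> p t 0 = p 0 0 / (1 + p 0 0 * t)"
  shows "t_star p = (if p 0 0 \<le> 1 / 6 then 0 else 6 - 1 / p 0 0)"
proof (cases "p 0 0 \<le> 1 / 6")
  case True
  then show ?thesis by (auto simp: t_star_def intro: Least_equality)
next
  case False
  have "p s 0 \<le> 1 / 6 \<longleftrightarrow> 6 - 1 / p 0 0 \<le> s" if "0 \<le> s" for s
  proof -
    have "0 < 1 + p 0 0 * s" using that assms(1) by (simp add: add_pos_nonneg)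
    then show ?thesis unfolding sol[OF that] using False by (simp add: divide_simps) (auto simp: algebra_simps)
  qed
  moreover have "0 \<le> 6 - 1 / p 0 0" using False by (simp add: field_simps)
  ultimately show ?thesis using False unfolding t_star_def
    by (intro Least_equality) auto
qed

text \<open>The lower bound requires times bounded away from 0 and positive initial mass at 0.
  \<open>0 < t_star p\<close> secures both; without it, \<open>t0\<close> and
  \<open>p 0 \<noteq> dirac 1\<close> supply them.\<close>

theorem theorem1:
  fixes p :: "real \<Rightarrow> nat \<Rightarrow> real"
  assumes "ode_solution p"
    and "\<And>t. 0 \<le> t \<Longrightarrow> p t \<in> prob_with_mean 1"
  shows "(0 < t_star p \<longrightarrow>
            (\<exists>C1>0. \<exists>C2>0. \<forall>t\<ge>t_star p. C1 / t \<le> gini (p t) \<and> gini (p t) \<le> C2 / t)) \<and>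
         (p 0 \<noteq> dirac 1 \<longrightarrow>
            (\<forall>t0>0. \<exists>C1>0. \<exists>C2>0. \<forall>t\<ge>t_star p. t0 \<le> t \<longrightarrow>
               C1 / t \<le> gini (p t) \<and> gini (p t) \<le> C2 / t)) \<and>
         (\<exists>C2>0. \<forall>t\<ge>t_star p. 0 < t \<longrightarrow> gini (p t) \<le> C2 / t) \<and>
         gini (dirac 1) = 0 \<and>
         (p 0 \<noteq> dirac 1 \<longrightarrow> (\<lambda>t. gini (p t)) \<in> \<Theta>[at_top](\<lambda>t. 1 / t))"
proof -
  define a where "a = p 0 0"
  have mass_nonneg: "0 \<le> p t 0" if "0 \<le> t" for t
    using prob_with_meanD(1)[OF assms(2)[OF that]] .
  then have a: "0 \<le> a" by (simp add: a_def)
  have sol: "p t 0 = a / (1 + a * t)" if "0 \<le> t" for t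
    unfolding a_def using assms(1) mass_nonneg that
    by (intro neg_square_ode_solution[of "\<lambda>t. p t 0"]) (auto simp: ode_solution_def)
  have t_star: "t_star p = (if a \<le> 1 / 6 then 0 else 6 - 1 / a)"
    by (rule t_star_eq[of p, folded a_def]) (use a sol in auto)
  have upper: "gini (p t) \<le> 2 / t" if "0 < t" for t
  proof -
    have "a / (1 + a * t) \<le> 1 / t" using a that by (simp add: field_simps add_pos_nonneg)
    then show ?thesis using gini_bounds(2)[OF assms(2), of t] sol[of t] that by simp
  qed
  \<comment> \<open>\<open>t * p t 0 = a * t / (1 + a * t)\<close> increases with \<open>t\<close>,
    so its value at \<open>t0\<close> serves as the constant.\<close>
  have lower: "(a * t0 / (1 + a * t0)) / t \<le> gini (p t)" if "0 < a" "0 < t0" "t0 \<le> t" for t t0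
  proof -
    have pos: "0 < 1 + a * t0" "0 < 1 + a * t" "0 < t"
      using that by (simp_all add: add_pos_nonneg)
    have "a * t0 / (1 + a * t0) \<le> a * t / (1 + a * t)"
      using pos that by (simp add: field_simps)
    also have "\<dots> = p t 0 * t" using sol[of t] pos by simp
    also have "\<dots> \<le> gini (p t) * t"
      using gini_bounds(1)[OF assms(2), of t] pos by simp
    finally show ?thesis using pos by (simp only: pos_divide_le_eq)
  qed
  have both: "\<exists>C1>0. \<exists>C2>0. \<forall>t\<ge>t0. C1 / t \<le> gini (p t) \<and> gini (p t) \<le> C2 / t"
    if "0 < a" "0 < t0" for t0
  proof -
    define C1 where "C1 = a * t0 / (1 + a * t0)"
    have "0 < C1" using that by (simp add: C1_def add_pos_pos)
    moreover have "C1 / t \<le> gini (p t) \<and> gini (p t) \<le> 2 / t" if "t0 \<le> t" for t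
      using lower[of t0 t, folded C1_def] upper[of t] \<open>0 < a\<close> \<open>0 < t0\<close> that by auto
    ultimately show ?thesis using zero_less_numeral by blast
  qed
  have a_pos: "0 < a" if "p 0 \<noteq> dirac 1"
    using eq_dirac_if_zero_mass_eq_0[OF assms(2)[of 0]] that a by (auto simp: a_def)
  \<comment> \<open>A positive \<open>t_star p\<close> forces \<open>a > 1 / 6\<close>, so
    \<open>both\<close> applies with \<open>t0 = t_star p\<close>.\<close>
  have "\<exists>C1>0. \<exists>C2>0. \<forall>t\<ge>t_star p. C1 / t \<le> gini (p t) \<and> gini (p t) \<le> C2 / t"
    if "0 < t_star p"
    using both[OF _ that] that t_star by (auto split: if_splits)
  moreover have "\<forall>t0>0. \<exists>C1>0. \<exists>C2>0. \<forall>t\<ge>t_star p. t0 \<le> t \<longrightarrow>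
      C1 / t \<le> gini (p t) \<and> gini (p t) \<le> C2 / t" if "p 0 \<noteq> dirac 1"
    using both[OF a_pos[OF that]] by meson
  \<comment> \<open>Time 0 is excluded because \<open>C2 / 0 = 0\<close> would force the Gini index
    to vanish there.\<close>
  moreover have "\<exists>C2>0. \<forall>t\<ge>t_star p. 0 < t \<longrightarrow> gini (p t) \<le> C2 / t"
    using upper by (intro exI[of _ 2]) auto
  \<comment> \<open>Both bounds are multiples of the mass at 0, which is zero here.\<close>
  moreover have "gini (dirac 1) = 0"
    using gini_bounds[of "dirac 1"] dirac_in_prob_with_mean[of 1] by (simp add: dirac_def)
  moreover have "(\<lambda>t. gini (p t)) \<in> \<Theta>[at_top](\<lambda>t. 1 / t)" if nontrivial: "p 0 \<noteq> dirac 1"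
  proof -
    obtain C1 C2 where C: "0 < C1" "0 < C2"
      and bnd: "\<And>t. 1 \<le> t \<Longrightarrow> C1 / t \<le> gini (p t) \<and> gini (p t) \<le> C2 / t"
      using both[OF a_pos[OF nontrivial], of 1] by auto
    \<comment> \<open>Nonnegativity removes the norms from the Landau bounds.\<close>
    have gini_nonneg: "0 \<le> gini (p t)" if "1 \<le> t" for t
    proof -
      have "0 \<le> C1 / t" using C that by simp
      then show ?thesis using bnd[OF that] by linarith
    qed
    show ?thesis
    proof (rule bigthetaI)
      show "(\<lambda>t. gini (p t)) \<in> O(\<lambda>t. 1 / t)"
        by (rule bigoI[of _ C2], rule eventually_at_top_linorderI[of 1])
          (use bnd gini_nonneg in auto)
      show "(\<lambda>t. gini (p t)) \<in> \<Omega>(\<lambda>t. 1 / t)"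
        by (rule landau_omega.bigI[OF C(1)], rule eventually_at_top_linorderI[of 1])
          (use bnd gini_nonneg in auto)
    qed
  qed
  ultimately show ?thesis by blast
qed

end
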